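(* For all $A,B,B',C\in\widehat{\mathbb F_q}$ and all $x,y,t\in\mathbb F_q$ with $t\neq1$, $$\frac1{q-1}\sum_{\theta}\binom{A\overline C\theta}{\theta}\mathbb F_1(A\theta;B,B';C;x,y)\,\theta(t)=\varepsilon(t)\,\overline A(1-t)\;\mathbb F_1\left(A;B,B';C;\frac x{1-t},\frac y{1-t}\right)-\varepsilon(xy)\,\overline AC(-t)\,\overline B(1-x)\,\overline{B'}(1-y),$$ where $\theta$ ranges over all of $\widehat{\mathbb F_q}$.
   Context: Let $p$ be a prime, $r\ge1$ an integer, $q=p^r$, and $\mathbb F_q$ the finite field with $q$ elements. $\widehat{\mathbb F_q}$ denotes the group of (complex-valued) multiplicative characters of $\mathbb F_q^*$; every character $\chi$, including the trivial character $\varepsilon$, is extended to $\mathbb F_q$ by $\chi(0)=0$. $\overline\chi$ is the inverse of $\chi$. Juxtaposition of characters denotes their product, and e.g. $AC(-1)$ means $(AC)(-1)$, $\overline AC$ means the product of $\overline A$ and $C$. For $A,B\in\widehat{\mathbb F_q}$, the Jacobi sum is $J(A,B)=\sum_{u\in\mathbb F_q}A(u)B(1-u)$, and $$\binom AB=B(-1)J(A,\overline B).$$ For $A,B,B',C\in\widehat{\mathbb F_q}$ and $x,y\in\mathbb F_q$, $$\mathbb F_1(A;B,B';C;x,y)=\varepsilon(xy)\,AC(-1)\sum_{u\in\mathbb F_q}A(u)\,\overline AC(1-u)\,\overline B(1-ux)\,\overline{B'}(1-uy).$$ *)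

theory Defs
  imports Complex_Main "HOL-Library.FuncSet" "HOL-Library.Cardinality"
begin

text \<open>The field with \<open>q = p^r\<close> elements is an arbitrary type \<open>'a\<close> of sort \<open>{field,finite}\<close>,
  with \<open>q = CARD('a)\<close>.\<close>

text \<open>Homomorphisms from the units of \<open>'a\<close> to the nonzero complex numbers, extended to \<open>'a\<close>
  by the value \<open>0\<close> at \<open>0\<close>. With this convention the group operations on characters are the
  pointwise ones on functions.\<close>

definition mult_chars :: "('a::{field,finite} \<Rightarrow> complex) set" where
  "mult_chars = {\<chi>. \<chi> 0 = 0 \<and> (\<forall>x. x \<noteq> 0 \<longrightarrow> \<chi> x \<noteq> 0) \<and>
                     (\<forall>x y. x \<noteq> 0 \<longrightarrow> y \<noteq> 0 \<longrightarrow> \<chi> (x * y) = \<chi> x * \<chi> y)}"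

definition triv_char :: "'a::{field,finite} \<Rightarrow> complex" where
  "triv_char x = (if x = 0 then 0 else 1)"

definition char_mult ::
    "('a::{field,finite} \<Rightarrow> complex) \<Rightarrow> ('a \<Rightarrow> complex) \<Rightarrow> 'a \<Rightarrow> complex"  (infixl "\<odot>" 70) where
  "\<chi> \<odot> \<psi> = (\<lambda>x. \<chi> x * \<psi> x)"

text \<open>At \<open>0\<close> this relies on \<open>inverse 0 = 0\<close>.\<close>

definition char_inv :: "('a::{field,finite} \<Rightarrow> complex) \<Rightarrow> 'a \<Rightarrow> complex" where
  "char_inv \<chi> = (\<lambda>x. inverse (\<chi> x))"

definition jacobi_sum :: "('a::{field,finite} \<Rightarrow> complex) \<Rightarrow> ('a \<Rightarrow> complex) \<Rightarrow> complex" where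
  "jacobi_sum A B = (\<Sum>u\<in>UNIV. A u * B (1 - u))"

text \<open>Not normalised by \<open>1/q\<close>, in contrast to Greene's binomial coefficient.\<close>

definition char_binom :: "('a::{field,finite} \<Rightarrow> complex) \<Rightarrow> ('a \<Rightarrow> complex) \<Rightarrow> complex" where
  "char_binom A B = B (- 1) * jacobi_sum A (char_inv B)"

definition appell_F1 ::
    "('a::{field,finite} \<Rightarrow> complex) \<Rightarrow> ('a \<Rightarrow> complex) \<Rightarrow> ('a \<Rightarrow> complex) \<Rightarrow> ('a \<Rightarrow> complex)
      \<Rightarrow> 'a \<Rightarrow> 'a \<Rightarrow> complex" where
  "appell_F1 A B B' C x y =
     triv_char (x * y) * (A \<odot> C) (- 1) *
     (\<Sum>u\<in>UNIV. A u * (char_inv A \<odot> C) (1 - u) *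
                char_inv B (1 - u * x) * char_inv B' (1 - u * y))"

text \<open>Finiteness matters because a sum over an infinite set would be \<open>0\<close> by convention.\<close>

lemma finite_mult_chars: "finite (mult_chars :: ('a::{field,finite} \<Rightarrow> complex) set)"
proof -
  have ord: "\<exists>k\<ge>1. x ^ k = 1" if "x \<noteq> 0" for x :: 'a
  proof -
    have "\<not> inj (\<lambda>n::nat. x ^ n)"
      using finite_imageD[of "\<lambda>n::nat. x ^ n" UNIV] by auto
    then obtain m n :: nat where "m < n" "x ^ m = x ^ n"
      by (metis injI linorder_neqE_nat)
    then have "x ^ m * x ^ (n - m) = x ^ m * 1"
      using power_add[of x m "n - m"] by simp
    then show ?thesis
      using that \<open>m < n\<close> by (intro exI[of _ "n - m"]) simp
  qed
  define k where "k x = (SOME k. k \<ge> 1 \<and> x ^ k = 1)" for x :: 'a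
  have k: "k x \<ge> 1 \<and> x ^ k x = 1" if "x \<noteq> 0" for x
    unfolding k_def by (rule someI_ex) (rule ord[OF that])
  define S :: "'a \<Rightarrow> complex set" where "S x = (if x = 0 then {0} else {z. z ^ k x = 1})" for x
  have "finite (S x)" for x
    using k[of x] by (auto simp: S_def intro!: finite_roots_unity)
  then have "finite (Pi\<^sub>E UNIV S)"
    by (intro finite_PiE) auto
  moreover have "\<chi> \<in> Pi\<^sub>E UNIV S" if "\<chi> \<in> mult_chars" for \<chi>
  proof -
    have 0: "\<chi> 0 = 0" and nz: "\<And>x. x \<noteq> 0 \<Longrightarrow> \<chi> x \<noteq> 0"
      and mult: "\<And>x y. x \<noteq> 0 \<Longrightarrow> y \<noteq> 0 \<Longrightarrow> \<chi> (x * y) = \<chi> x * \<chi> y"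
      using that by (auto simp: mult_chars_def)
    have 1: "\<chi> 1 = 1"
      using mult[of 1 1] nz[of 1] by simp
    have "\<chi> (x ^ n) = \<chi> x ^ n" if "x \<noteq> 0" for x n
      using that by (induction n) (simp_all add: 1 mult)
    then have "\<chi> x \<in> S x" for x
      using k[of x] by (auto simp: S_def 0) (metis 1)
    then show ?thesis by auto
  qed
  ultimately show ?thesis
    by (meson finite_subset subsetI)
qed

end

theory Submission
  imports Defs "HOL-Algebra.Multiplicative_Group"
begin

text \<open>
  Expand the binomial coefficient as a sum over \<open>v\<close> and the Appell function as a sum over \<open>u\<close>.
  The signs \<open>\<theta>(-1)\<close> cancel in pairs, and \<open>\<theta>\<close> then enters only through its value at
  \<open>v u t / ((1 - v) (1 - u))\<close>. By orthogonality the sum over \<open>\<theta>\<close> keeps exactly those pairs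
  \<open>(u, v)\<close> for which this quotient is \<open>1\<close>, and for given \<open>u \<noteq> 0, 1\<close> and \<open>t \<noteq> 0\<close> that forces
  \<open>v = (1 - u) / (1 - u (1 - t))\<close>. At this \<open>v\<close> the factor \<open>A\<close>-inverse times \<open>C\<close> of \<open>1 - u\<close> turns
  into the same character at \<open>1 - u (1 - t)\<close>
  (lemma \<open>inner_sum_collapse\<close>).
  What remains is a sum over all \<open>u \<noteq> 1\<close>. Completing it by the term \<open>u = 1\<close> and substituting
  \<open>w = u (1 - t)\<close> gives the Appell function at \<open>x / (1 - t)\<close>, \<open>y / (1 - t)\<close>; the added
  term is the one subtracted on the right-hand side.

  Orthogonality over the dual group (lemma \<open>sum_mult_chars\<close>) rests on the
  multiplicative group being cyclic: a character is determined by its value at a generator, which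
  may be any root of unity of order dividing \<open>q - 1\<close>. Thus there are \<open>q - 1\<close> characters, and they
  separate the points of the group.
\<close>

section \<open>Multiplicative characters as functions on the whole field\<close>

lemma mult_char_0: "\<chi> \<in> mult_chars \<Longrightarrow> \<chi> 0 = 0"
  and mult_char_nonzero: "\<chi> \<in> mult_chars \<Longrightarrow> x \<noteq> 0 \<Longrightarrow> \<chi> x \<noteq> 0"
  by (auto simp: mult_chars_def)

text \<open>Because \<open>\<chi> 0 = 0\<close>, and \<open>z / 0 = 0\<close> both in the field and in the complex numbers,
  multiplicativity and its version for quotients extend to all arguments. This makes it possible to
  collect the factors of a summand inside one character even where a denominator vanishes.\<close>

lemma mult_char_mult: "\<chi> \<in> mult_chars \<Longrightarrow> \<chi> (x * y) = \<chi> x * \<chi> y"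
  by (cases "x = 0 \<or> y = 0") (auto simp: mult_chars_def)

lemma mult_char_1: "\<chi> \<in> mult_chars \<Longrightarrow> \<chi> 1 = 1"
  using mult_char_mult[of \<chi> 1 1] mult_char_nonzero[of \<chi> 1] by simp

lemma mult_char_power: "\<chi> \<in> mult_chars \<Longrightarrow> \<chi> (x ^ n) = \<chi> x ^ n"
  by (induction n) (simp_all add: mult_char_1 mult_char_mult)

lemma mult_char_divide:
  assumes "\<chi> \<in> mult_chars"
  shows "\<chi> (x / y) = \<chi> x / \<chi> y"
proof (cases "y = 0")
  case False
  then have "\<chi> (x / y) * \<chi> y = \<chi> x"
    using mult_char_mult[OF assms, of "x / y" y] by simp
  then show ?thesis
    using mult_char_nonzero[OF assms False] by (simp add: field_simps)
qed (simp add: mult_char_0[OF assms])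

lemma mult_char_minus_1_square:
  assumes "\<chi> \<in> mult_chars"
  shows "\<chi> (- 1) * \<chi> (- 1) = 1"
  using mult_char_mult[OF assms, of "- 1" "- 1"] mult_char_1[OF assms] by simp

lemma mult_char_inverse_minus_1:
  assumes "\<chi> \<in> mult_chars"
  shows "inverse (\<chi> (- 1)) = \<chi> (- 1)"
  using mult_char_minus_1_square[OF assms] by (rule inverse_unique)

lemma mult_chars_closed:
  assumes "\<chi> \<in> mult_chars" "\<psi> \<in> mult_chars"
  shows "\<chi> \<odot> \<psi> \<in> mult_chars"
  using assms by (auto simp: mult_chars_def char_mult_def)

section \<open>Orthogonality over the group of characters\<close>

text \<open>The standard fact on finite fields, transferred from the carrier-based formulation.\<close>

lemma finite_field_generator:
  obtains g :: "'a::{field,finite}" where "g \<noteq> 0" "\<And>x. x \<noteq> 0 \<Longrightarrow> \<exists>i::nat. x = g ^ i"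
proof -
  define R :: "'a ring"
    where "R = \<lparr>carrier = UNIV, mult = (*), one = 1, zero = 0, add = (+)\<rparr>"
  have sel [simp]: "carrier R = UNIV" "mult R = (*)" "one R = 1" "zero R = 0" "add R = (+)"
    by (simp_all add: R_def)
  have "abelian_group R"
    by (rule abelian_groupI) (auto simp: algebra_simps intro: right_minus)
  then have "cring R"
    by (rule cringI) (auto simp: algebra_simps intro!: comm_monoidI)
  then interpret R: Ring.field R
    by (rule cring.cring_fieldI2) (auto intro: right_inverse)
  have pow: "a [^]\<^bsub>R\<^esub> (i::nat) = a ^ i" for a i
    by (induction i) (simp_all add: mult.commute)
  have "\<exists>a\<in>carrier (mult_of R). carrier (mult_of R) = {a [^]\<^bsub>R\<^esub> i |i::nat. i \<in> UNIV}"
    by (rule R.finite_field_mult_group_has_gen) simp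
  then have "\<exists>g\<in>UNIV - {0::'a}. UNIV - {0} = {g ^ i |i::nat. i \<in> UNIV}"
    by (simp only: carrier_mult_of pow sel)
  then obtain g :: 'a where "g \<in> UNIV - {0}" "UNIV - {0} = {g ^ i |i::nat. i \<in> UNIV}"
    by blast
  then show thesis
    by (intro that[of g]) blast+
qed

text \<open>Multiplication by \<open>x\<close> permutes the nonzero elements, so it does not change their product.\<close>

lemma finite_field_power_card:
  fixes x :: "'a::{field,finite}"
  assumes "x \<noteq> 0"
  shows "x ^ (CARD('a) - 1) = 1"
proof -
  have "(\<Prod>y\<in>UNIV - {0}. x * y) = (\<Prod>y\<in>UNIV - {0}. y)"
    by (rule prod.reindex_bij_witness[of _ "\<lambda>y. y / x" "\<lambda>y. x * y"]) (use assms in auto)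
  then have "x ^ card (UNIV - {0::'a}) * (\<Prod>y\<in>UNIV - {0}. y) = 1 * (\<Prod>y\<in>UNIV - {0::'a}. y)"
    by (simp add: prod.distrib)
  then show ?thesis
    by (simp add: card_Diff_singleton)
qed

text \<open>Exponents of a generator are determined modulo the group order, which is what makes
  \<open>g ^ i \<mapsto> z ^ i\<close> well defined for a root of unity \<open>z\<close>.\<close>

lemma generator_power_eq_iff:
  fixes g :: "'a::{field,finite}"
  assumes "g \<noteq> 0" and gen: "\<And>x. x \<noteq> 0 \<Longrightarrow> \<exists>i::nat. x = g ^ i"
  shows "g ^ i = g ^ j \<longleftrightarrow> i mod (CARD('a) - 1) = j mod (CARD('a) - 1)"
proof -
  define n where "n = CARD('a) - 1"
  have card: "card (UNIV - {0::'a}) = n"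
    by (simp add: n_def card_Diff_singleton)
  then have "n > 0"
    by (metis Diff_iff UNIV_I card_gt_0_iff empty_iff finite singletonD zero_neq_one)
  have red: "g ^ k = g ^ (k mod n)" for k
  proof -
    have "g ^ k = g ^ (n * (k div n) + k mod n)" by simp
    also have "\<dots> = (g ^ n) ^ (k div n) * g ^ (k mod n)"
      by (simp only: power_add power_mult)
    finally show ?thesis
      using finite_field_power_card[OF \<open>g \<noteq> 0\<close>] by (simp add: n_def)
  qed
  have "UNIV - {0} \<subseteq> (\<lambda>k. g ^ k) ` {..<n}"
  proof
    fix x :: 'a assume "x \<in> UNIV - {0}"
    then obtain k where "x = g ^ k" using gen by auto
    with red[of k] \<open>n > 0\<close> show "x \<in> (\<lambda>k. g ^ k) ` {..<n}"
      by (intro image_eqI[of _ _ "k mod n"]) auto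
  qed
  then have "n \<le> card ((\<lambda>k. g ^ k) ` {..<n})"
    using card by (metis card_mono finite)
  then have "inj_on (\<lambda>k. g ^ k) {..<n}"
    by (intro eq_card_imp_inj_on) (auto intro!: antisym card_image_le[of "{..<n}", simplified])
  then have "g ^ (i mod n) = g ^ (j mod n) \<longleftrightarrow> i mod n = j mod n"
    using \<open>n > 0\<close> by (auto dest: inj_onD)
  then show ?thesis
    using red[of i] red[of j] by (simp add: n_def)
qed

lemma bij_betw_mult_chars_roots_unity:
  fixes g :: "'a::{field,finite}"
  assumes "g \<noteq> 0" and gen: "\<And>x. x \<noteq> 0 \<Longrightarrow> \<exists>i::nat. x = g ^ i"
  shows "bij_betw (\<lambda>\<chi>. \<chi> g) mult_chars {z. z ^ (CARD('a) - 1) = 1}"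
  unfolding bij_betw_def
proof
  define n where "n = CARD('a) - 1"
  show "inj_on (\<lambda>\<chi>. \<chi> g) mult_chars"
  proof (intro inj_onI ext)
    fix \<chi> \<psi> :: "'a \<Rightarrow> complex" and x
    assume *: "\<chi> \<in> mult_chars" "\<psi> \<in> mult_chars" "\<chi> g = \<psi> g"
    then show "\<chi> x = \<psi> x"
      using gen[of x] by (cases "x = 0") (auto simp: mult_char_0 mult_char_power)
  qed
  have "\<exists>\<chi>\<in>mult_chars. \<chi> g = z" if z: "z ^ n = 1" for z
  proof
    define d where "d x = (SOME i. x = g ^ i)" for x
    define \<chi> where "\<chi> x = (if x = 0 then 0 else z ^ d x)" for x :: 'a
    have d: "g ^ d x = x" if "x \<noteq> 0" for x
      unfolding d_def using someI_ex[OF gen[OF that]] by simp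
    have red: "z ^ k = z ^ (k mod n)" for k
    proof -
      have "z ^ k = z ^ (n * (k div n) + k mod n)" by simp
      also have "\<dots> = (z ^ n) ^ (k div n) * z ^ (k mod n)"
        by (simp only: power_add power_mult)
      finally show ?thesis using z by simp
    qed
    have \<chi>_power: "\<chi> (g ^ i) = z ^ i" for i
    proof -
      have "g ^ d (g ^ i) = g ^ i" using d \<open>g \<noteq> 0\<close> by simp
      then have "d (g ^ i) mod n = i mod n"
        using generator_power_eq_iff[OF assms] by (simp add: n_def)
      then show ?thesis
        using red[of i] red[of "d (g ^ i)"] \<open>g \<noteq> 0\<close> by (simp add: \<chi>_def)
    qed
    have "z \<noteq> 0"
    proof
      assume "z = 0"
      moreover have "n \<noteq> 0"
        using card_mono[of UNIV "{0, 1::'a}"] by (simp add: n_def)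
      ultimately show False using z by (simp add: power_0_left)
    qed
    moreover have "\<chi> (x * y) = \<chi> x * \<chi> y" if "x \<noteq> 0" "y \<noteq> 0" for x y
      using \<chi>_power[of "d x + d y"] \<chi>_power[of "d x"] \<chi>_power[of "d y"] d that
      by (simp add: power_add)
    ultimately show "\<chi> \<in> mult_chars"
      by (auto simp: mult_chars_def \<chi>_def)
    show "\<chi> g = z" using \<chi>_power[of 1] by simp
  qed
  then show "(\<lambda>\<chi>. \<chi> g) ` mult_chars = {z. z ^ (CARD('a) - 1) = 1}"
    using finite_field_power_card[OF \<open>g \<noteq> 0\<close>]
    by (auto simp: n_def mult_char_1 simp flip: mult_char_power)
qed

lemma card_mult_chars:
  "card (mult_chars :: ('a::{field,finite} \<Rightarrow> complex) set) = CARD('a) - 1"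
proof -
  obtain g :: 'a where g: "g \<noteq> 0" "\<And>x. x \<noteq> 0 \<Longrightarrow> \<exists>i::nat. x = g ^ i"
    using finite_field_generator by blast
  have "CARD('a) - 1 > 0"
    using card_mono[of UNIV "{0, 1::'a}"] by simp
  then show ?thesis
    using bij_betw_same_card[OF bij_betw_mult_chars_roots_unity[OF g]] card_roots_unity_eq by metis
qed

text \<open>The character that sends a generator to a primitive root of unity is injective, hence
  detects every \<open>a \<noteq> 1\<close>.\<close>

lemma mult_char_separates:
  fixes a :: "'a::{field,finite}"
  assumes "a \<noteq> 0" "a \<noteq> 1"
  obtains \<psi> where "\<psi> \<in> mult_chars" "\<psi> a \<noteq> 1"
proof -
  define n where "n = CARD('a) - 1"
  have "n > 0"
    using card_mono[of UNIV "{0, 1::'a}"] by (simp add: n_def)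
  obtain g :: 'a where g: "g \<noteq> 0" "\<And>x. x \<noteq> 0 \<Longrightarrow> \<exists>i::nat. x = g ^ i"
    using finite_field_generator by blast
  obtain i where a: "a = g ^ i" using g(2) assms(1) by blast
  have "\<not> n dvd i"
    using generator_power_eq_iff[OF g, of i 0] a assms(2) by (simp add: n_def dvd_eq_mod_eq_0)
  define z where "z = cis (2 * pi / real n)"
  have "z ^ n = 1"
    using \<open>n > 0\<close> by (simp add: z_def DeMoivre)
  have "z ^ i \<noteq> 1"
  proof
    assume "z ^ i = 1"
    then have "cos (2 * pi * real i / real n) = 1"
      by (simp add: z_def DeMoivre complex_eq_iff mult.commute)
    then obtain k :: int where "2 * pi * real i / real n = of_int k * 2 * pi"
      by (auto simp: cos_one_2pi_int)
    then have "real i = of_int k * real n"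
      using \<open>n > 0\<close> by (simp add: field_simps)
    then have "int i = k * int n"
      by (metis of_int_eq_iff of_int_mult of_int_of_nat_eq)
    then show False
      using \<open>\<not> n dvd i\<close> by (metis dvd_triv_right int_dvd_int_iff)
  qed
  moreover obtain \<psi> where "\<psi> \<in> mult_chars" "\<psi> g = z"
    using bij_betw_imp_surj_on[OF bij_betw_mult_chars_roots_unity[OF g]] \<open>z ^ n = 1\<close>
    by (force simp: n_def)
  ultimately show thesis
    using that[of \<psi>] by (simp add: a mult_char_power)
qed

text \<open>For \<open>a \<noteq> 1\<close>, multiplication by a character that is not \<open>1\<close> at \<open>a\<close> permutes all characters
  and scales the sum, which must therefore vanish.\<close>

lemma sum_mult_chars:
  fixes a :: "'a::{field,finite}"
  shows "(\<Sum>\<theta>\<in>mult_chars. \<theta> a) = (if a = 1 then of_nat CARD('a) - 1 else 0)"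
proof -
  consider "a = 0" | "a = 1" | "a \<noteq> 0" "a \<noteq> 1" by blast
  then show ?thesis
  proof cases
    case 1
    then show ?thesis by (simp add: mult_char_0)
  next
    case 2
    then show ?thesis by (simp add: mult_char_1 card_mult_chars of_nat_diff)
  next
    case 3
    then obtain \<psi> where \<psi>: "\<psi> \<in> mult_chars" "\<psi> a \<noteq> 1"
      by (rule mult_char_separates)
    have inj: "inj_on (\<lambda>\<theta>. \<psi> \<odot> \<theta>) mult_chars"
    proof (intro inj_onI ext)
      fix \<theta> \<eta> :: "'a \<Rightarrow> complex" and x
      assume *: "\<theta> \<in> mult_chars" "\<eta> \<in> mult_chars" "\<psi> \<odot> \<theta> = \<psi> \<odot> \<eta>"
      have "\<psi> x * \<theta> x = \<psi> x * \<eta> x"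
        using fun_cong[OF *(3), of x] by (simp add: char_mult_def)
      then show "\<theta> x = \<eta> x"
        using *(1,2) mult_char_nonzero[OF \<psi>(1), of x] by (cases "x = 0") (simp_all add: mult_char_0)
    qed
    have "(\<lambda>\<theta>. \<psi> \<odot> \<theta>) ` mult_chars = mult_chars"
      by (rule endo_inj_surj[OF finite_mult_chars _ inj]) (auto intro: mult_chars_closed \<psi>)
    then have "(\<Sum>\<theta>\<in>mult_chars. \<theta> a) = (\<Sum>\<theta>\<in>mult_chars. (\<psi> \<odot> \<theta>) a)"
      using sum.reindex[OF inj, of "\<lambda>\<theta>. \<theta> a"] by simp
    also have "\<dots> = \<psi> a * (\<Sum>\<theta>\<in>mult_chars. \<theta> a)"
      by (simp add: char_mult_def sum_distrib_left)
    finally have "(\<psi> a - 1) * (\<Sum>\<theta>\<in>mult_chars. \<theta> a) = 0"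
      by (simp add: algebra_simps)
    then show ?thesis using \<psi>(2) 3 by simp
  qed
qed

section \<open>The generating function of the Appell series\<close>

text \<open>Because division by \<open>0\<close> gives \<open>0\<close>, this holds at \<open>u = 1\<close> and \<open>v = 1\<close> as well: both sides
  vanish there.\<close>

lemma theta_factors:
  assumes "\<theta> \<in> mult_chars"
  shows "\<theta> (- 1) * \<theta> (- 1) * (\<theta> v * inverse (\<theta> (1 - v))) * (\<theta> u * inverse (\<theta> (1 - u))) * \<theta> t
         = \<theta> (v * u * t / ((1 - v) * (1 - u)))"
  using assms
  by (simp add: mult_char_minus_1_square mult_char_divide mult_char_mult)
     (simp add: divide_inverse ac_simps)

lemma orthogonality_condition_iff:
  fixes u v t :: "'a::field"
  shows "v * u * t / ((1 - v) * (1 - u)) = 1 \<longleftrightarrow>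
         t \<noteq> 0 \<and> u \<noteq> 0 \<and> u \<noteq> 1 \<and> 1 - u * (1 - t) \<noteq> 0 \<and> v = (1 - u) / (1 - u * (1 - t))"
    (is "?L \<longleftrightarrow> ?R")
proof
  assume ?L
  then have nz: "1 - v \<noteq> 0" "1 - u \<noteq> 0" and eq: "v * u * t = (1 - v) * (1 - u)"
    by auto
  then have "v \<noteq> 0" "u \<noteq> 0" "t \<noteq> 0" by auto
  have *: "v * (1 - u * (1 - t)) = 1 - u"
    using eq by (simp add: algebra_simps)
  then have "1 - u * (1 - t) \<noteq> 0"
    using nz by auto
  then show ?R
    using * nz \<open>u \<noteq> 0\<close> \<open>t \<noteq> 0\<close> by (auto simp: nonzero_eq_divide_eq)
next
  assume R: ?R
  then have *: "v * (1 - u * (1 - t)) = 1 - u"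
    by simp
  have eq: "v * u * t = (1 - v) * (1 - u)"
    using * by (simp add: algebra_simps)
  moreover have "v \<noteq> 0" using R by simp
  ultimately have "(1 - v) * (1 - u) \<noteq> 0"
    using R by (metis mult_eq_0_iff)
  then show ?L using eq by simp
qed

text \<open>The only surviving \<open>v\<close> contributes \<open>A(v) / C(v)\<close>, whose numerator \<open>1 - u\<close> cancels the factor
  \<open>C(1 - u) / A(1 - u)\<close>. No \<open>v\<close> survives for \<open>u = 0\<close>, \<open>u (1 - t) = 1\<close> or \<open>u = 1\<close>. In the
  first two cases the resulting product is \<open>0\<close> as well, but for \<open>u = 1\<close> it is \<open>C(t) / A(t)\<close>,
  whence the case distinction. This missing value is the source of the subtracted term in the
  final formula.\<close>

lemma inner_sum_collapse:
  fixes A C :: "'a::{field,finite} \<Rightarrow> complex"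
  assumes A: "A \<in> mult_chars" and C: "C \<in> mult_chars"
  shows "(\<Sum>v\<in>UNIV. A v * inverse (C v) * A u * (inverse (A (1 - u)) * C (1 - u)) *
             (if v * u * t / ((1 - v) * (1 - u)) = 1 then 1 else 0))
         = triv_char t * (if u = 1 then 0
             else A u * (inverse (A (1 - u * (1 - t))) * C (1 - u * (1 - t))))"
proof -
  define P where "P \<longleftrightarrow> t \<noteq> 0 \<and> u \<noteq> 0 \<and> u \<noteq> 1 \<and> 1 - u * (1 - t) \<noteq> 0"
  define v0 where "v0 = (1 - u) / (1 - u * (1 - t))"
  define h where "h v = A v * inverse (C v) * A u * (inverse (A (1 - u)) * C (1 - u))" for v
  have "(\<Sum>v\<in>UNIV. h v * (if v * u * t / ((1 - v) * (1 - u)) = 1 then 1 else 0))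
        = (\<Sum>v\<in>UNIV. if v = v0 then (if P then h v0 else 0) else 0)"
    unfolding orthogonality_condition_iff by (intro sum.cong) (auto simp: P_def v0_def)
  also have "\<dots> = (if P then h v0 else 0)"
    by simp
  also have "\<dots> = triv_char t * (if u = 1 then 0
             else A u * (inverse (A (1 - u * (1 - t))) * C (1 - u * (1 - t))))"
  proof (cases P)
    case True
    then have "A (1 - u) \<noteq> 0" "C (1 - u) \<noteq> 0"
      by (simp_all add: P_def mult_char_nonzero[OF A] mult_char_nonzero[OF C])
    then show ?thesis
      using True
      by (simp add: P_def h_def v0_def triv_char_def mult_char_divide[OF A] mult_char_divide[OF C]
          field_simps)
  next
    case False
    then show ?thesis
      by (auto simp: P_def triv_char_def mult_char_0[OF A] mult_char_0[OF C])
  qed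
  finally show ?thesis
    unfolding h_def .
qed

text \<open>The sum over \<open>\<theta>\<close> is moved inside the sums over \<open>u\<close> and \<open>v\<close> and evaluated by orthogonality.
  The factors of the Appell function at \<open>1 - u x\<close> and \<open>1 - u y\<close> do not depend on \<open>\<theta>\<close> and enter
  as an arbitrary weight \<open>\<beta>\<close>.\<close>

lemma sum_over_characters:
  fixes A C \<beta> :: "'a::{field,finite} \<Rightarrow> complex"
  assumes A: "A \<in> mult_chars" and C: "C \<in> mult_chars"
  shows "(\<Sum>\<theta>\<in>mult_chars. char_binom (A \<odot> char_inv C \<odot> \<theta>) \<theta> *
            (\<theta> (- 1) * (\<Sum>u\<in>UNIV. (A \<odot> \<theta>) u * (char_inv (A \<odot> \<theta>) \<odot> C) (1 - u) * \<beta> u)) * \<theta> t)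
         = (of_nat CARD('a) - 1) * (triv_char t *
            (\<Sum>u\<in>UNIV - {1}. A u * (char_inv A \<odot> C) (1 - u * (1 - t)) * \<beta> u))"
proof -
  define k where "k u v = A v * inverse (C v) * A u * (inverse (A (1 - u)) * C (1 - u))" for u v
  have expand: "char_binom (A \<odot> char_inv C \<odot> \<theta>) \<theta> *
      (\<theta> (- 1) * (\<Sum>u\<in>UNIV. (A \<odot> \<theta>) u * (char_inv (A \<odot> \<theta>) \<odot> C) (1 - u) * \<beta> u)) * \<theta> t
      = (\<Sum>u\<in>UNIV. \<Sum>v\<in>UNIV. k u v * \<beta> u * \<theta> (v * u * t / ((1 - v) * (1 - u))))"
    if "\<theta> \<in> mult_chars" for \<theta>
  proof -
    have "char_binom (A \<odot> char_inv C \<odot> \<theta>) \<theta> *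
        (\<theta> (- 1) * (\<Sum>u\<in>UNIV. (A \<odot> \<theta>) u * (char_inv (A \<odot> \<theta>) \<odot> C) (1 - u) * \<beta> u)) * \<theta> t
      = (\<Sum>u\<in>UNIV. \<Sum>v\<in>UNIV. \<theta> (- 1) * (A v * inverse (C v) * \<theta> v * inverse (\<theta> (1 - v))) *
          (\<theta> (- 1) * (A u * \<theta> u * (inverse (A (1 - u) * \<theta> (1 - u)) * C (1 - u)) * \<beta> u)) * \<theta> t)"
      unfolding char_binom_def jacobi_sum_def char_mult_def char_inv_def
      by (simp only: sum_distrib_left sum_distrib_right)
    also have "\<dots> = (\<Sum>u\<in>UNIV. \<Sum>v\<in>UNIV. k u v * \<beta> u * \<theta> (v * u * t / ((1 - v) * (1 - u))))"
      unfolding theta_factors[OF that, symmetric]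
      by (intro sum.cong refl) (simp add: k_def ac_simps)
    finally show ?thesis .
  qed
  have "(\<Sum>\<theta>\<in>mult_chars. \<Sum>u\<in>UNIV. \<Sum>v\<in>UNIV. k u v * \<beta> u * \<theta> (v * u * t / ((1 - v) * (1 - u))))
        = (\<Sum>u\<in>UNIV. \<Sum>v\<in>UNIV. \<Sum>\<theta>\<in>mult_chars.
             k u v * \<beta> u * \<theta> (v * u * t / ((1 - v) * (1 - u))))"
    by (subst sum.swap, rule sum.cong[OF refl], rule sum.swap)
  also have "\<dots> = (\<Sum>u\<in>UNIV. (of_nat CARD('a) - 1) * \<beta> u *
      (\<Sum>v\<in>UNIV. k u v * (if v * u * t / ((1 - v) * (1 - u)) = 1 then 1 else 0)))"
    by (simp only: sum_mult_chars sum_distrib_left[symmetric])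
       (auto simp: sum_distrib_left intro!: sum.cong)
  also have "\<dots> = (\<Sum>u\<in>UNIV. if u = 1 then 0 else (of_nat CARD('a) - 1) * (triv_char t *
      (A u * (char_inv A \<odot> C) (1 - u * (1 - t)) * \<beta> u)))"
    unfolding k_def inner_sum_collapse[OF A C]
    by (intro sum.cong) (auto simp: char_mult_def char_inv_def)
  also have "\<dots> = (\<Sum>u\<in>UNIV - {1}. (of_nat CARD('a) - 1) * (triv_char t *
      (A u * (char_inv A \<odot> C) (1 - u * (1 - t)) * \<beta> u)))"
    by (intro sum.mono_neutral_cong_right) auto
  also have "\<dots> = (of_nat CARD('a) - 1) * (triv_char t *
      (\<Sum>u\<in>UNIV - {1}. A u * (char_inv A \<odot> C) (1 - u * (1 - t)) * \<beta> u))"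
    by (simp only: sum_distrib_left)
  finally show ?thesis
    by (simp add: expand)
qed

text \<open>Substitute \<open>w = u s\<close>. The prefactor stays the same, since \<open>x y\<close> and \<open>(x / s) (y / s)\<close>
  vanish together.\<close>

lemma appell_F1_rescale:
  fixes A B B' C :: "'a::{field,finite} \<Rightarrow> complex"
  assumes A: "A \<in> mult_chars" and "s \<noteq> 0"
  shows "triv_char (x * y) * (A \<odot> C) (- 1) *
      (\<Sum>u\<in>UNIV. A u * (char_inv A \<odot> C) (1 - u * s) * (char_inv B (1 - u * x) * char_inv B' (1 - u * y)))
    = char_inv A s * appell_F1 A B B' C (x / s) (y / s)"
proof -
  have scale: "A (w / s) = char_inv A s * A w" for w
    by (subst mult_char_divide[OF A]) (simp add: char_inv_def divide_inverse)
  have "(\<Sum>u\<in>UNIV. A u * (char_inv A \<odot> C) (1 - u * s) *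
            (char_inv B (1 - u * x) * char_inv B' (1 - u * y)))
      = (\<Sum>w\<in>UNIV. A (w / s) * (char_inv A \<odot> C) (1 - w) *
            (char_inv B (1 - w * (x / s)) * char_inv B' (1 - w * (y / s))))"
    by (rule sum.reindex_bij_witness[of _ "\<lambda>w. w / s" "\<lambda>u. u * s"]) (use \<open>s \<noteq> 0\<close> in auto)
  also have "\<dots> = char_inv A s * (\<Sum>w\<in>UNIV. A w * (char_inv A \<odot> C) (1 - w) *
            char_inv B (1 - w * (x / s)) * char_inv B' (1 - w * (y / s)))"
    by (simp only: scale sum_distrib_left mult.assoc)
  finally show ?thesis
    using \<open>s \<noteq> 0\<close> by (simp add: appell_F1_def triv_char_def)
qed

theorem theorem4p1:
  fixes A B B' C :: "'a::{field,finite} \<Rightarrow> complex" and x y t :: 'a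
  assumes "A \<in> mult_chars" and "B \<in> mult_chars" and "B' \<in> mult_chars" and "C \<in> mult_chars"
    and "t \<noteq> 1"
  shows "1 / (of_nat CARD('a) - 1) *
           (\<Sum>\<theta>\<in>mult_chars.
              char_binom (A \<odot> char_inv C \<odot> \<theta>) \<theta> * appell_F1 (A \<odot> \<theta>) B B' C x y * \<theta> t)
         = triv_char t * char_inv A (1 - t) * appell_F1 A B B' C (x / (1 - t)) (y / (1 - t))
           - triv_char (x * y) * (char_inv A \<odot> C) (- t) * char_inv B (1 - x) * char_inv B' (1 - y)"
proof -
  note A = \<open>A \<in> mult_chars\<close> and C = \<open>C \<in> mult_chars\<close>
  define \<beta> where "\<beta> u = char_inv B (1 - u * x) * char_inv B' (1 - u * y)" for u
  define K where "K = triv_char (x * y) * (A \<odot> C) (- 1)"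
  define f where "f u = A u * (char_inv A \<odot> C) (1 - u * (1 - t)) * \<beta> u" for u
  have q: "(of_nat CARD('a) - 1 :: complex) \<noteq> 0"
    using card_mono[of UNIV "{0, 1::'a}"] by auto
  have "(\<Sum>\<theta>\<in>mult_chars.
           char_binom (A \<odot> char_inv C \<odot> \<theta>) \<theta> * appell_F1 (A \<odot> \<theta>) B B' C x y * \<theta> t)
      = K * (\<Sum>\<theta>\<in>mult_chars. char_binom (A \<odot> char_inv C \<odot> \<theta>) \<theta> *
          (\<theta> (- 1) * (\<Sum>u\<in>UNIV. (A \<odot> \<theta>) u * (char_inv (A \<odot> \<theta>) \<odot> C) (1 - u) * \<beta> u)) * \<theta> t)"
    unfolding sum_distrib_left[of K]
    by (intro sum.cong refl)
       (simp add: appell_F1_def K_def \<beta>_def char_mult_def[of _ C] char_mult_def[of A] mult_ac)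
  also have "\<dots> = K * ((of_nat CARD('a) - 1) * (triv_char t * (\<Sum>u\<in>UNIV - {1}. f u)))"
    unfolding sum_over_characters[OF A C] f_def ..
  also have "(\<Sum>u\<in>UNIV - {1}. f u) = (\<Sum>u\<in>UNIV. f u) - f 1"
    by (simp add: sum_diff1)
  finally have "1 / (of_nat CARD('a) - 1) * (\<Sum>\<theta>\<in>mult_chars.
           char_binom (A \<odot> char_inv C \<odot> \<theta>) \<theta> * appell_F1 (A \<odot> \<theta>) B B' C x y * \<theta> t)
      = triv_char t * (K * (\<Sum>u\<in>UNIV. f u)) - triv_char t * (K * f 1)"
    using q by (simp add: field_simps)
  also have "K * (\<Sum>u\<in>UNIV. f u)
      = char_inv A (1 - t) * appell_F1 A B B' C (x / (1 - t)) (y / (1 - t))"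
    unfolding K_def f_def \<beta>_def using appell_F1_rescale[OF A] \<open>t \<noteq> 1\<close> by simp
  also have "triv_char t * (K * f 1)
      = triv_char (x * y) * (char_inv A \<odot> C) (- t) * char_inv B (1 - x) * char_inv B' (1 - y)"
  proof -
    \<comment> \<open>The sign in \<open>- t\<close> absorbs the prefactor, because \<open>A (- 1)\<close> is its own inverse.\<close>
    have "(char_inv A \<odot> C) (- t) = (A \<odot> C) (- 1) * (char_inv A \<odot> C) t"
      using mult_char_mult[OF A, of "- 1" t] mult_char_mult[OF C, of "- 1" t]
      by (simp add: char_mult_def char_inv_def mult_char_inverse_minus_1[OF A])
    moreover have "triv_char t * (char_inv A \<odot> C) t = (char_inv A \<odot> C) t"
      by (simp add: triv_char_def char_mult_def mult_char_0[OF C])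
    ultimately show ?thesis
      by (simp add: K_def f_def \<beta>_def mult_char_1[OF A] mult_ac)
  qed
  finally show ?thesis
    by (simp add: mult.assoc)
qed

end
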